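(* Let $Q$ be a prime power, let $m$ be a positive integer, and put $q=Q^m$. Let $h(x)\in\mathbb{F}_q[x]$ and let $r$ be a positive integer. Then $x^r h\bigl(x^{(q-1)/(Q-1)}\bigr)$ permutes $\mathbb{F}_q$ if and only if both of the following hold: (1) $\gcd\bigl(r,(q-1)/(Q-1)\bigr)=1$; and (2) $g(x):=x^r h(x)\, h^{(Q)}(x)\, h^{(Q^2)}(x)\cdots h^{(Q^{m-1})}(x)$ permutes $\mathbb{F}_Q$, where $h^{(Q^i)}(x)$ denotes the polynomial obtained from $h(x)$ by raising every coefficient to the $Q^i$-th power.
   Context: For a prime power $Q$, $\mathbb{F}_Q$ denotes the finite field with $Q$ elements, and it is regarded as a subfield of $\mathbb{F}_{Q^m}$. A polynomial $f(x)$ permutes a finite field $\mathbb{F}$ if the function $\alpha\mapsto f(\alpha)$ is a bijection from $\mathbb{F}$ to itself. *)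

theory Defs
  imports
    "HOL-Number_Theory.Prime_Powers"
    "HOL-Algebra.Algebraic_Closure_Type"
begin

definition permutes_field :: "'a::comm_semiring_0 set \<Rightarrow> 'a poly \<Rightarrow> bool" where
  "permutes_field F f \<longleftrightarrow> bij_betw (poly f) F F"

(* Used only with n > 0, so that 0 ^ n = 0, as map_poly expects. *)
definition coeff_power :: "nat \<Rightarrow> 'a::field poly \<Rightarrow> 'a poly" where
  "coeff_power n h = map_poly (\<lambda>c. c ^ n) h"

end

theory Submission
  imports Defs "HOL-Number_Theory.Residues"
begin

text \<open>
  Write \<open>k = (q - 1) / (Q - 1)\<close>. The norm \<open>N(x) = x ^ k\<close> maps the big field onto the small one, and
  on the small field the coefficient twists of \<open>h\<close> evaluate to Frobenius powers of \<open>h\<close>, so that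
  \<open>g(y) = y ^ r * h(y) ^ k\<close>. Hence \<open>f(x) = x ^ r * h(x ^ k)\<close> satisfies \<open>N \<circ> f = g \<circ> N\<close>: on the fibres
  of \<open>N\<close>, \<open>f\<close> is a multiple of the \<open>r\<close>-th power map, which is injective there iff \<open>r\<close> is coprime
  to \<open>k\<close>, while \<open>g\<close> describes how \<open>f\<close> moves the fibres.
\<close>

lemma card_nth_roots_le:
  fixes c :: "'a::idom"
  assumes "n > 0"
  shows "card {x. x ^ n = c} \<le> n"
proof -
  let ?p = "monom 1 n - [:c:]"
  have "coeff ?p n = 1"
    using assms by (cases n) auto
  hence "?p \<noteq> 0"
    by (metis coeff_0 zero_neq_one)
  moreover have "degree ?p \<le> n"
    by (intro degree_diff_le degree_monom_le) auto
  moreover have "{x. x ^ n = c} = {x. poly ?p x = 0}"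
    by (auto simp: poly_monom)
  ultimately show ?thesis
    using card_poly_roots_bound[of ?p] by simp
qed

lemma finite_field_power_card_minus_one:
  fixes x :: "'a::finite_field"
  assumes "x \<noteq> 0"
  shows "x ^ (card (UNIV :: 'a set) - 1) = 1"
proof -
  have "x * x ^ (card (UNIV :: 'a set) - 1) = x * 1"
    using finite_field_power_card_eq_same[of x] finite_UNIV_card_ge_0[where ?'a = 'a]
    by (simp flip: power_Suc)
  thus ?thesis
    using assms by (metis mult_cancel_left)
qed

lemma subfield_type_algebra_closed:
  fixes K :: "'a::field set"
  assumes "subfield K (ring_of_type_algebra :: 'a ring)"
  shows "0 \<in> K" "\<And>x y. x \<in> K \<Longrightarrow> y \<in> K \<Longrightarrow> x * y \<in> K"
  using subringE(2,6)[OF subfieldE(1)[OF assms]] by (auto simp: ring_of_type_algebra_def)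

text \<open>Multiplication by a nonzero element of \<open>K\<close> permutes \<open>K - {0}\<close>;
  comparing products gives the inclusion from left to right. The root bound for a polynomial of
  degree \<open>card K - 1\<close> then leaves no room for further roots.\<close>

lemma subfield_type_algebra_nonzero_eq:
  fixes K :: "'a::finite_field set"
  assumes K: "subfield K (ring_of_type_algebra :: 'a ring)" and "card K > 1"
  shows "K - {0} = {x. x ^ (card K - 1) = 1}"
proof (rule card_seteq)
  have card: "card (K - {0}) = card K - 1"
    using subfield_type_algebra_closed(1)[OF K] by simp
  show "K - {0} \<subseteq> {x. x ^ (card K - 1) = 1}"
  proof safe
    fix x assume x: "x \<in> K" "x \<noteq> 0"
    have "inj_on (\<lambda>y. x * y) (K - {0})"
      using x by (auto simp: inj_on_def)
    moreover have "(\<lambda>y. x * y) ` (K - {0}) \<subseteq> K - {0}"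
      using x subfield_type_algebra_closed(2)[OF K] by auto
    ultimately have "bij_betw (\<lambda>y. x * y) (K - {0}) (K - {0})"
      by (simp add: bij_betw_def endo_inj_surj)
    hence "(\<Prod>y\<in>K - {0}. x * y) = \<Prod>(K - {0})"
      using prod.reindex_bij_betw[of "\<lambda>y. x * y" _ _ "\<lambda>y. y"] by simp
    hence "x ^ (card K - 1) * \<Prod>(K - {0}) = 1 * \<Prod>(K - {0})"
      by (simp add: prod.distrib card)
    moreover have "\<Prod>(K - {0}) \<noteq> 0"
      by simp
    ultimately show "x ^ (card K - 1) = 1"
      by (metis mult_cancel_right)
  qed
  show "card {x :: 'a. x ^ (card K - 1) = 1} \<le> card (K - {0})"
    unfolding card using assms(2) by (intro card_nth_roots_le) simp
qed simp

text \<open>Makes raising to the power \<open>Q\<close> additive. The characteristic divides the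
  field size, a power of the prime beneath \<open>Q\<close>, so it is that prime.\<close>

lemma finite_field_card_eq_power_imp_power_CHAR:
  assumes "primepow Q" and "card (UNIV :: 'a::finite_field set) = Q ^ m"
  shows "\<exists>e. Q = CHAR('a) ^ e"
proof -
  obtain p e where p: "Factorial_Ring.prime p" "Q = p ^ e"
    using assms(1) by (auto simp: primepow_def)
  have char: "Factorial_Ring.prime CHAR('a)"
    using finite_imp_CHAR_pos[where ?'a = 'a] by (intro prime_CHAR_semidom) auto
  have "CHAR('a) dvd (p ^ e) ^ m"
    using CHAR_dvd_CARD[where ?'a = 'a] assms(2) p(2) by simp
  hence "CHAR('a) dvd p"
    using char prime_dvd_power by blast
  hence "CHAR('a) = p"
    using char p(1) primes_dvd_imp_eq by blast
  thus ?thesis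
    using p(2) by blast
qed

text \<open>For a power \<open>n\<close> of the characteristic, raising to the power
  \<open>n\<close> is a ring endomorphism; as it fixes \<open>y\<close>, it commutes with evaluation
  at \<open>y\<close>.\<close>

lemma poly_coeff_power:
  fixes y :: "'a::finite_field"
  assumes "n = CHAR('a) ^ e" and "y ^ n = y"
  shows "poly (coeff_power n h) y = poly h y ^ n"
proof -
  have char: "Factorial_Ring.prime CHAR('a)"
    using finite_imp_CHAR_pos[where ?'a = 'a] by (intro prime_CHAR_semidom) auto
  hence "n > 0"
    using assms(1) by (simp add: prime_gt_0_nat)
  show ?thesis
    unfolding coeff_power_def
  proof (induction h)
    case (pCons c h)
    have "poly (map_poly (\<lambda>c. c ^ n) (pCons c h)) y = c ^ n + y * poly h y ^ n"
      using \<open>n > 0\<close> pCons by (simp add: map_poly_pCons)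
    also have "\<dots> = c ^ n + (y * poly h y) ^ n"
      by (simp add: power_mult_distrib assms(2))
    also have "\<dots> = poly (pCons c h) y ^ n"
      using freshmans_dream'[OF char assms(1)] by simp
    finally show ?case .
  qed (use \<open>n > 0\<close> in simp)
qed

lemma power_power_eq_self:
  fixes y :: "'a::monoid_mult"
  assumes "y ^ n = y"
  shows "y ^ (n ^ i) = y"
  by (induction i) (simp_all add: assms power_mult)

lemma poly_prod_coeff_power:
  fixes y :: "'a::finite_field"
  assumes "n = CHAR('a) ^ e" and "y ^ n = y"
  shows "poly (\<Prod>i<m. coeff_power (n ^ i) h) y = poly h y ^ (\<Sum>i<m. n ^ i)"
proof -
  have "poly (coeff_power (n ^ i) h) y = poly h y ^ (n ^ i)" for i
    by (rule poly_coeff_power[where e = "e * i"])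
       (use assms power_power_eq_self in \<open>auto simp: power_mult\<close>)
  thus ?thesis
    by (simp add: poly_prod power_sum)
qed

text \<open>Identifies the norm exponent with the exponent collected from the \<open>m\<close>
  twists of \<open>h\<close>.\<close>

lemma geometric_sum_nat:
  assumes "(n::nat) > 1"
  shows "n ^ m - 1 = (n - 1) * (\<Sum>i<m. n ^ i)" "(n ^ m - 1) div (n - 1) = (\<Sum>i<m. n ^ i)"
proof -
  have "int (n ^ m - 1) = int ((n - 1) * (\<Sum>i<m. n ^ i))"
    using power_diff_1_eq[of "int n" m] assms by (simp add: of_nat_diff)
  thus *: "n ^ m - 1 = (n - 1) * (\<Sum>i<m. n ^ i)"
    by (simp only: of_nat_eq_iff)
  show "(n ^ m - 1) div (n - 1) = (\<Sum>i<m. n ^ i)"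
    unfolding * using assms by simp
qed

text \<open>Counting takes the place of cyclicity of the unit group: the \<open>s * k\<close> units
  lie in fibres of size at most \<open>k\<close>, so the image has at least \<open>s\<close>
  elements, while there are at most \<open>s\<close> roots of \<open>t ^ s = 1\<close>.\<close>

lemma power_image_eq_nth_roots_of_unity:
  assumes "card (UNIV :: 'a::finite_field set) - 1 = s * k" and "s > 0" and "k > 0"
  shows "(\<lambda>x::'a. x ^ k) ` (- {0}) = {t. t ^ s = 1}"
proof (rule card_seteq)
  let ?I = "(\<lambda>x::'a. x ^ k) ` (- {0})"
  show "?I \<subseteq> {t. t ^ s = 1}"
  proof safe
    fix x :: 'a assume "x \<noteq> 0"
    thus "(x ^ k) ^ s = 1"
      using finite_field_power_card_minus_one[of x] assms(1)
      by (simp add: mult.commute flip: power_mult)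
  qed
  have "k * s = card (- {0 :: 'a})"
    using assms(1) by (simp add: Compl_eq_Diff_UNIV)
  also have "\<dots> \<le> card (\<Union>t\<in>?I. {x. x ^ k = t})"
    by (intro card_mono) auto
  also have "\<dots> \<le> (\<Sum>t\<in>?I. card {x. x ^ k = t})"
    by (intro card_UN_le) auto
  also have "\<dots> \<le> (\<Sum>t\<in>?I. k)"
    by (intro sum_mono card_nth_roots_le assms)
  also have "\<dots> = k * card ?I"
    by simp
  finally have "s \<le> card ?I"
    using assms(3) by simp
  with card_nth_roots_le[OF assms(2), of "1 :: 'a"]
  show "card {t :: 'a. t ^ s = 1} \<le> card ?I"
    by linarith
qed simp

text \<open>Write the number of units as \<open>d * e\<close>. Each \<open>u ^ e\<close> is a
  \<open>d\<close>-th root of unity; if all of these were 1, then \<open>u ^ e = 1\<close> would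
  have \<open>d * e > e\<close> solutions.\<close>

lemma nontrivial_root_of_unity_exists:
  assumes "d dvd card (UNIV :: 'a::finite_field set) - 1"
    and "card (UNIV :: 'a set) > 1" and "d \<noteq> 1"
  shows "\<exists>z::'a. z \<noteq> 1 \<and> z ^ d = 1"
proof (rule ccontr)
  assume "\<nexists>z::'a. z \<noteq> 1 \<and> z ^ d = 1"
  hence triv: "z = 1" if "z ^ d = 1" for z :: 'a
    using that by blast
  obtain e where e: "card (UNIV :: 'a set) - 1 = d * e"
    using assms(1) by blast
  with assms(2) have "d > 0" "e > 0"
    by (auto intro!: gr0I)
  have "u ^ e = 1" if "u \<noteq> 0" for u :: 'a
  proof (rule triv)
    show "(u ^ e) ^ d = 1"
      using finite_field_power_card_minus_one[OF that] unfolding e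
      by (simp add: mult.commute flip: power_mult)
  qed
  hence "card (- {0 :: 'a}) \<le> card {u :: 'a. u ^ e = 1}"
    by (intro card_mono) auto
  also have "\<dots> \<le> e"
    using \<open>e > 0\<close> by (rule card_nth_roots_le)
  finally have "d * e \<le> 1 * e"
    using e by (simp add: Compl_eq_Diff_UNIV)
  with \<open>d > 0\<close> \<open>e > 0\<close> assms(3) show False
    by simp
qed

lemma power_eq_one_coprime:
  fixes z :: "'a::monoid_mult"
  assumes "z ^ r = 1" "z ^ k = 1" "coprime r k"
  shows "z = 1"
\<comment> \<open>The Bezout identity over the naturals, with \<open>+ 1\<close> on the side of
  \<open>k\<close>, fails for \<open>r = 0\<close>, \<open>k = 1\<close>.\<close>
proof (cases "k = 1")
  case False
  then obtain a b where "r * a = k * b + 1"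
    using coprime_bezout_strong[OF assms(3)] by blast
  hence "(z ^ r) ^ a = (z ^ k) ^ b * z"
    by (metis power_mult power_add power_one_right)
  thus ?thesis
    using assms by simp
qed (use assms in simp)

theorem theorem1p1:
  fixes Q m q r :: nat
    and FQ :: "'a::finite_field set"
    and h :: "'a poly"
  assumes "primepow Q"
    and "m > 0"
    and "q = Q ^ m"
    and "card (UNIV :: 'a set) = q"
    and "subfield FQ (ring_of_type_algebra :: 'a ring)"
    and "card FQ = Q"
    and "r > 0"
  shows "permutes_field UNIV (monom 1 r * pcompose h (monom 1 ((q - 1) div (Q - 1)))) \<longleftrightarrow>
    gcd r ((q - 1) div (Q - 1)) = 1 \<and>
    permutes_field FQ (monom 1 r * (\<Prod>i<m. coeff_power (Q ^ i) h))"
proof -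
  define k where "k = (q - 1) div (Q - 1)"
  define f where "f = (\<lambda>x. x ^ r * poly h (x ^ k))"
  define g where "g = poly (monom 1 r * (\<Prod>i<m. coeff_power (Q ^ i) h))"
  have Q: "Q > 1"
    using assms(1) by (rule primepow_gt_Suc_0[unfolded One_nat_def[symmetric]])
  have k_sum: "k = (\<Sum>i<m. Q ^ i)" and q1: "card (UNIV :: 'a set) - 1 = (Q - 1) * k"
    using geometric_sum_nat[OF Q, of m] assms(3,4) by (simp_all add: k_def)
  have q_gt_1: "card (UNIV :: 'a set) > 1"
    using assms(2-4) Q one_less_power[of Q m] by simp
  with q1 have "k > 0"
    by (auto intro!: gr0I)
  have FQ_nonzero: "FQ - {0} = {x. x ^ (Q - 1) = 1}"
    using subfield_type_algebra_nonzero_eq[OF assms(5)] assms(6) Q by simp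
  have "0 \<in> FQ"
    by (rule subfield_type_algebra_closed[OF assms(5)])
  have norm_image: "range (\<lambda>x. x ^ k) = FQ"
  proof -
    have "(\<lambda>x::'a. x ^ k) ` (- {0}) = FQ - {0}"
      unfolding FQ_nonzero using q1 Q \<open>k > 0\<close> by (intro power_image_eq_nth_roots_of_unity) auto
    moreover have "range (\<lambda>x::'a. x ^ k) = insert (0 ^ k) ((\<lambda>x. x ^ k) ` (- {0}))"
      by auto
    ultimately show ?thesis
      using \<open>0 \<in> FQ\<close> zero_power[OF \<open>k > 0\<close>, where ?'a = 'a] by (simp add: insert_absorb)
  qed
  have FQ_power: "y ^ Q = y" if "y \<in> FQ" for y
  proof (cases "y = 0")
    case False
    hence "y ^ (Q - 1) = 1"
      using that FQ_nonzero by blast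
    thus ?thesis
      using Q by (metis Suc_diff_1 less_trans mult.right_neutral power_Suc zero_less_one)
  qed (use Q in simp)
  obtain e where e: "Q = CHAR('a) ^ e"
    using finite_field_card_eq_power_imp_power_CHAR[OF assms(1)] assms(3,4) by blast
  have g_eq: "g y = y ^ r * poly h y ^ k" if "y \<in> FQ" for y
    unfolding g_def k_sum using poly_prod_coeff_power[OF e FQ_power[OF that]]
    by (simp add: poly_monom)
  \<comment> \<open>The commuting square of the norm with \<open>f\<close> and \<open>g\<close>,
    which drives both directions.\<close>
  have norm_f: "f x ^ k = g (x ^ k)" for x
  proof -
    have "x ^ k \<in> FQ"
      using norm_image by blast
    thus ?thesis
      by (simp add: g_eq f_def power_mult_distrib mult.commute flip: power_mult)
  qed
  have "g ` FQ \<subseteq> FQ"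
  proof
    fix z assume "z \<in> g ` FQ"
    then obtain x where "z = f x ^ k"
      using norm_f norm_image by force
    thus "z \<in> FQ"
      using norm_image by blast
  qed
  have "bij f \<longleftrightarrow> coprime r k \<and> bij_betw g FQ FQ"
  proof (intro iffI conjI)
    assume f: "bij f"
    show "coprime r k"
    proof (rule ccontr)
      assume "\<not> coprime r k"
      hence "gcd r k \<noteq> 1"
        by (simp add: coprime_iff_gcd_eq_1)
      moreover have "gcd r k dvd card (UNIV :: 'a set) - 1"
        unfolding q1 by simp
      \<comment> \<open>\<open>f\<close> sees its argument only through its \<open>r\<close>-th and
        \<open>k\<close>-th powers, so it cannot tell \<open>z\<close> from 1.\<close>
      ultimately obtain z :: 'a where "z \<noteq> 1" "z ^ gcd r k = 1"
        using nontrivial_root_of_unity_exists q_gt_1 by blast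
      moreover from this have "z ^ r = 1" "z ^ k = 1"
        by (metis gcd_dvd1 dvdE power_mult power_one, metis gcd_dvd2 dvdE power_mult power_one)
      hence "f z = f 1"
        by (simp add: f_def)
      ultimately show False
        using f by (auto simp: bij_def inj_def)
    qed
    have "FQ \<subseteq> g ` FQ"
    proof
      fix y assume "y \<in> FQ"
      \<comment> \<open>Surjectivity of the norm followed by surjectivity of \<open>f\<close>.
        Injectivity of \<open>g\<close> comes later from finiteness.\<close>
      then obtain x where "y = f x ^ k"
        using norm_image f by (metis bij_pointE rangeE)
      thus "y \<in> g ` FQ"
        using norm_f norm_image by blast
    qed
    with \<open>g ` FQ \<subseteq> FQ\<close> show "bij_betw g FQ FQ"
      by (simp add: bij_betw_def eq_card_imp_inj_on subset_antisym)
  next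
    assume *: "coprime r k \<and> bij_betw g FQ FQ"
    hence g_inj: "inj_on g FQ"
      by (simp add: bij_betw_def)
    have "inj f"
    proof (rule injI)
      fix x y assume "f x = f y"
      have in_FQ: "x ^ k \<in> FQ" "y ^ k \<in> FQ"
        using norm_image by blast+
      have xy: "x ^ k = y ^ k"
        using inj_onD[OF g_inj _ in_FQ] \<open>f x = f y\<close> norm_f by metis
      show "x = y"
      proof (cases "y = 0")
        case True
        thus ?thesis
          using xy \<open>k > 0\<close> by (simp add: zero_power)
      next
        case False
        \<comment> \<open>Since \<open>r > 0\<close>, \<open>g 0 = 0\<close>; injectivity of
          \<open>g\<close> thus keeps \<open>poly h (y ^ k)\<close> nonzero, so that it cancels from
          \<open>f x = f y\<close>.\<close>
        have "g (y ^ k) \<noteq> g 0"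
          using inj_onD[OF g_inj _ in_FQ(2) \<open>0 \<in> FQ\<close>] False by auto
        hence "poly h (y ^ k) \<noteq> 0"
          using g_eq[OF in_FQ(2)] g_eq[OF \<open>0 \<in> FQ\<close>] \<open>k > 0\<close> assms(7)
          by (auto simp: zero_power)
        hence "x ^ r = y ^ r"
          using \<open>f x = f y\<close> xy by (simp add: f_def)
        \<comment> \<open>The quotient is both an \<open>r\<close>-th and a \<open>k\<close>-th root
          of unity.\<close>
        hence "x / y = 1"
          using xy False * by (subst power_eq_one_coprime[of _ r k]) (auto simp: power_divide)
        thus ?thesis
          using False by simp
      qed
    qed
    thus "bij f"
      by (simp add: bij_def finite_UNIV_inj_surj)
  qed
  moreover have "poly (monom 1 r * pcompose h (monom 1 k)) = f"
    by (auto simp: f_def poly_monom poly_pcompose)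
  ultimately show ?thesis
    unfolding permutes_field_def k_def[symmetric] g_def coprime_iff_gcd_eq_1 by metis
qed

end
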